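(* There are absolute constants $C,C'>0$ such that for every $n\ge 2$ and every connected simple undirected graph $G_0$ on $n$ nodes, the two-hop walk process started from $G_0$ satisfies: with probability at least $1-C'\frac{\log n}{n}$, the graph $G_T$ with $T=\lceil Cn\log^2 n\rceil$ is the complete graph on the $n$ nodes.
   Context: Two-hop walk process (undirected): $G_0$ is a connected simple undirected graph on an $n$-node vertex set $V$. Given $G_t$, in round $t$ every node $x$ independently picks a neighbor $v$ of $x$ in $G_t$ uniformly at random, then a neighbor $w$ of $v$ in $G_t$ uniformly at random, and the edge $\{x,w\}$ is added (nothing happens if $w=x$ or the edge already exists); $G_{t+1}$ is $G_t$ together with all edges added in round $t$. Edges are never removed. *)

theory Defs
  imports "HOL-Probability.Probability"
begin

text \<open>Vertex set is {..<n}. A simple undirected graph is a set of 2-element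
vertex sets (its edges).\<close>

definition all_pairs :: "nat \<Rightarrow> nat set set" where
  "all_pairs n = {{x, y} | x y. x < n \<and> y < n \<and> x \<noteq> y}"

definition simple_graph :: "nat \<Rightarrow> nat set set \<Rightarrow> bool" where
  "simple_graph n E \<longleftrightarrow> E \<subseteq> all_pairs n"

definition complete_graph :: "nat \<Rightarrow> nat set set" where
  "complete_graph n = all_pairs n"

definition nbrs :: "nat set set \<Rightarrow> nat \<Rightarrow> nat set" where
  "nbrs E x = {v. {x, v} \<in> E}"

definition adj_rel :: "nat set set \<Rightarrow> (nat \<times> nat) set" where
  "adj_rel E = {(x, y). {x, y} \<in> E}"

definition connected_graph :: "nat \<Rightarrow> nat set set \<Rightarrow> bool" where
  "connected_graph n E \<longleftrightarrow> (\<forall>x<n. \<forall>y<n. (x, y) \<in> (adj_rel E)\<^sup>*)"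

text \<open>One round: every node x independently picks a uniform neighbour v, then a
uniform neighbour w of v; the edge {x,w} is added unless w = x.\<close>

definition two_hop_choice :: "nat set set \<Rightarrow> nat \<Rightarrow> nat pmf" where
  "two_hop_choice E x = bind_pmf (pmf_of_set (nbrs E x)) (\<lambda>v. pmf_of_set (nbrs E v))"

definition two_hop_step :: "nat \<Rightarrow> nat set set \<Rightarrow> nat set set pmf" where
  "two_hop_step n E =
     map_pmf (\<lambda>f. E \<union> {{x, f x} | x. x < n \<and> f x \<noteq> x})
             (Pi_pmf {..<n} 0 (two_hop_choice E))"

text \<open>Distribution of G_t given G_0 = E0.\<close>

fun two_hop_process :: "nat \<Rightarrow> nat set set \<Rightarrow> nat \<Rightarrow> nat set set pmf" where
  "two_hop_process n E0 0 = return_pmf E0"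
| "two_hop_process n E0 (Suc t) = bind_pmf (two_hop_process n E0 t) (two_hop_step n)"

end

theory Submission
  imports Defs
begin

text \<open>
  Every O(n log n) rounds the minimum degree d at least doubles (or reaches n - 1), with
  failure probability at most 1/n; about log n such phases complete the graph.

  For one phase, fix a vertex u whose degree stays below 2d, write A for its closed
  neighbourhood, and fix a walk of length at most 4 from u in the initial graph. Either the
  two-hop choice of u leaves A with constant probability, or nearly every vertex of A has
  degree O(d) and most of its neighbours in A. In the second case a vertex b with
  k >= 1 neighbours in the \<open>core\<close> (the vertices of A with at least d/2 neighbours in A)
  gains a new one with probability of order k/n, until k >= d/2; from then on u links to b
  with probability of order 1/n, and then b itself belongs to the core and passes this on
  to the next vertex of the walk. So at every moment one of a fixed finite family of increasing
  integer counters X grows with probability of order X/n, and the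
  expected reciprocal of their product decays by a factor 1 - c/n per round. Hence after
  O(n log n) rounds u has degree at least 2d or is adjacent to its whole ball of radius 4,
  and that ball has more than 2d vertices or is the whole vertex set.
\<close>

subsection \<open>The two-hop step\<close>

lemma simple_graph_edgeD:
  assumes "simple_graph n E" "{x, y} \<in> E"
  shows "x < n" "y < n" "x \<noteq> y"
proof -
  have "{x, y} \<in> all_pairs n" using assms by (auto simp: simple_graph_def)
  then obtain a b where ab: "{x, y} = {a, b}" "a < n" "b < n" "a \<noteq> b"
    unfolding all_pairs_def by blast
  then show "x < n" "y < n" "x \<noteq> y" by (auto simp: doubleton_eq_iff)
qed

lemma nbrs_sym: "x \<in> nbrs E y \<longleftrightarrow> y \<in> nbrs E x"
  by (simp add: nbrs_def insert_commute)

lemma nbrs_subset: "simple_graph n E \<Longrightarrow> nbrs E x \<subseteq> {..<n}"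
  by (auto simp: nbrs_def dest: simple_graph_edgeD)

lemma finite_nbrs: "simple_graph n E \<Longrightarrow> finite (nbrs E x)"
  by (rule finite_subset[OF nbrs_subset]) auto

lemma nbrs_irrefl: "simple_graph n E \<Longrightarrow> x \<notin> nbrs E x"
  using simple_graph_edgeD(3)[of n E x x] by (auto simp: nbrs_def)

lemma nbrs_mono: "E \<subseteq> E' \<Longrightarrow> nbrs E x \<subseteq> nbrs E' x"
  by (auto simp: nbrs_def)

lemma card_nbrs_le: "simple_graph n E \<Longrightarrow> card (nbrs E x) \<le> n"
  using card_mono[OF _ nbrs_subset, of n E x] by simp

lemma finite_all_pairs: "finite (all_pairs n)"
proof -
  have "all_pairs n \<subseteq> Pow {..<n}" by (auto simp: all_pairs_def)
  then show ?thesis by (rule finite_subset) simp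
qed

lemma finite_simple_graphs: "finite {E. simple_graph n E}"
  using finite_all_pairs[of n] by (auto simp: simple_graph_def)

section \<open>Expectations and probabilities of composed distributions\<close>

lemma expectation_bind_finite:
  fixes h :: "'b \<Rightarrow> real"
  assumes "finite (set_pmf p)" "\<And>x. x \<in> set_pmf p \<Longrightarrow> finite (set_pmf (f x))"
  shows "measure_pmf.expectation (p \<bind> f) h =
           measure_pmf.expectation p (\<lambda>x. measure_pmf.expectation (f x) h)"
proof -
  have "measure_pmf.expectation (p \<bind> f) h =
      (\<Sum>x\<in>set_pmf p. pmf p x *\<^sub>R measure_pmf.expectation (f x) h)"
    by (rule pmf_expectation_bind) (use assms in auto)
  also have "\<dots> = measure_pmf.expectation p (\<lambda>x. measure_pmf.expectation (f x) h)"
    by (rule integral_measure_pmf[symmetric]) (use assms in auto)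
  finally show ?thesis .
qed

text \<open>Failure probabilities of consecutive stages add up: \<open>indicator A x - b\<close>
  bounds the conditional success probability from below, on A by hypothesis and off A because
  \<open>b\<close> is nonnegative.\<close>

lemma prob_bind_ge:
  assumes "measure_pmf.prob p A \<ge> 1 - a" "\<And>x. x \<in> A \<Longrightarrow> x \<in> set_pmf p \<Longrightarrow> measure_pmf.prob (f x) B \<ge> 1 - b"
    and "b \<ge> 0"
  shows "measure_pmf.prob (p \<bind> f) B \<ge> 1 - (a + b)"
proof -
  let ?Q = "\<lambda>x. measure_pmf.prob (f x) B"
  have int: "integrable (measure_pmf p) ?Q"
    by (rule measure_pmf.integrable_const_bound[where B=1]) auto
  have "ennreal (measure_pmf.prob (p \<bind> f) B) = (\<integral>\<^sup>+x. ennreal (?Q x) \<partial>p)"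
    by (simp only: measure_pmf.emeasure_eq_measure[symmetric] emeasure_bind_pmf)
  also have "\<dots> = ennreal (measure_pmf.expectation p ?Q)"
    by (rule nn_integral_eq_integral[OF int]) simp
  finally have eq: "measure_pmf.prob (p \<bind> f) B = measure_pmf.expectation p ?Q"
    by simp
  have "measure_pmf.prob p A - b \<le> measure_pmf.expectation p (\<lambda>x. indicator A x - b)"
    by (subst Bochner_Integration.integral_diff) (auto intro: measure_pmf.integrable_const_bound[where B=1])
  also have "\<dots> \<le> measure_pmf.expectation p ?Q"
  proof (rule integral_mono_AE)
    show "integrable (measure_pmf p) (\<lambda>x. indicator A x - b :: real)"
      by (rule measure_pmf.integrable_const_bound[where B="1+\<bar>b\<bar>"]) (auto simp: indicator_def)
    show "AE x in measure_pmf p. indicator A x - b \<le> ?Q x"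
      unfolding AE_measure_pmf_iff
    proof
      fix x assume x: "x \<in> set_pmf p"
      show "indicator A x - b \<le> ?Q x"
      proof (cases "x \<in> A")
        case True
        then show ?thesis using assms(2)[OF True x] by simp
      next
        case False
        then show ?thesis
          using assms(3) by (simp add: order_trans[OF _ measure_nonneg])
      qed
    qed
  qed (rule int)
  finally show ?thesis using assms(1) eq by simp
qed

section \<open>The law of one round\<close>

lemma set_two_hop_choice:
  assumes "simple_graph n E" "nbrs E x \<noteq> {}" "w \<in> set_pmf (two_hop_choice E x)"
  shows "\<exists>v\<in>nbrs E x. w \<in> nbrs E v"
proof -
  from assms obtain v where v: "v \<in> nbrs E x" "w \<in> set_pmf (pmf_of_set (nbrs E v))"
    by (auto simp: two_hop_choice_def finite_nbrs)
  then have "nbrs E v \<noteq> {}" using nbrs_sym by blast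
  with v assms show ?thesis by (auto simp: finite_nbrs)
qed

text \<open>Averaging over the intermediate vertex. Later estimates keep only those \<open>v\<close>
  whose summand is known to be large.\<close>

lemma prob_two_hop_choice:
  assumes "simple_graph n E" "nbrs E x \<noteq> {}"
  shows "measure_pmf.prob (two_hop_choice E x) W =
    (\<Sum>v\<in>nbrs E x. real (card (nbrs E v \<inter> W)) / real (card (nbrs E v))) / real (card (nbrs E x))"
proof -
  have ne: "nbrs E v \<noteq> {}" if "v \<in> nbrs E x" for v using that nbrs_sym by blast
  have "measure_pmf.prob (two_hop_choice E x) W = measure_pmf.expectation (two_hop_choice E x) (indicator W)"
    by simp
  also have "\<dots> = (\<Sum>v\<in>nbrs E x. measure_pmf.expectation (pmf_of_set (nbrs E v)) (indicator W) /\<^sub>R real (card (nbrs E x)))"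
    unfolding two_hop_choice_def
    by (rule pmf_expectation_bind_pmf_of_set) (use assms ne in \<open>auto simp: finite_nbrs\<close>)
  also have "\<dots> = (\<Sum>v\<in>nbrs E x. real (card (nbrs E v \<inter> W)) / real (card (nbrs E v)) / real (card (nbrs E x)))"
    using assms ne by (intro sum.cong) (auto simp: finite_nbrs measure_pmf_of_set divide_inverse)
  finally show ?thesis by (simp add: sum_divide_distrib)
qed

text \<open>The deterministic half of a round. Separating it from the random choices lets events
  about the new graph be pulled back to the product space of choices, where independence is
  available.\<close>

definition hop_edges :: "nat \<Rightarrow> nat set set \<Rightarrow> (nat \<Rightarrow> nat) \<Rightarrow> nat set set" where
  "hop_edges n E f = E \<union> {{x, f x} | x. x < n \<and> f x \<noteq> x}"

lemma two_hop_step_alt: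
  "two_hop_step n E = map_pmf (hop_edges n E) (Pi_pmf {..<n} 0 (two_hop_choice E))"
  by (simp add: two_hop_step_def hop_edges_def[abs_def])

lemma set_two_hop_step:
  assumes "simple_graph n E" "\<And>x. x < n \<Longrightarrow> nbrs E x \<noteq> {}" "E' \<in> set_pmf (two_hop_step n E)"
  shows "E \<subseteq> E'" "simple_graph n E'"
proof -
  obtain f where f: "f \<in> set_pmf (Pi_pmf {..<n} 0 (two_hop_choice E))" and E': "E' = hop_edges n E f"
    using assms(3) by (auto simp: two_hop_step_alt)
  show "E \<subseteq> E'" by (auto simp: E' hop_edges_def)
  have "f x < n" if "x < n" for x
  proof -
    have "f x \<in> set_pmf (two_hop_choice E x)"
      using f that by (auto simp: set_Pi_pmf PiE_dflt_def)
    then show ?thesis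
      using set_two_hop_choice[OF assms(1) assms(2)[OF that]] nbrs_subset[OF assms(1)] by blast
  qed
  then have "{{x, f x} | x. x < n \<and> f x \<noteq> x} \<subseteq> all_pairs n"
    unfolding all_pairs_def by fast
  then show "simple_graph n E'"
    using assms(1) by (simp add: simple_graph_def E' hop_edges_def)
qed

lemma set_hop_choices:
  assumes "simple_graph n E" "\<And>x. x < n \<Longrightarrow> nbrs E x \<noteq> {}"
    and "f \<in> set_pmf (Pi_pmf {..<n} 0 (two_hop_choice E))"
  shows "simple_graph n (hop_edges n E f)"
  using set_two_hop_step(2)[OF assms(1,2)] assms(3) by (auto simp: two_hop_step_alt)

lemma prob_step_ge_choices:
  assumes "simple_graph n E" "\<And>x. x < n \<Longrightarrow> nbrs E x \<noteq> {}"
    and "\<And>f. f \<in> F \<Longrightarrow> simple_graph n (hop_edges n E f) \<Longrightarrow> P (hop_edges n E f)"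
  shows "measure_pmf.prob (Pi_pmf {..<n} 0 (two_hop_choice E)) F
    \<le> measure_pmf.prob (two_hop_step n E) {E'. P E'}"
proof -
  let ?M = "Pi_pmf {..<n} 0 (two_hop_choice E)"
  \<comment> \<open>Restricting to the support makes the resulting graph simple, which is why
    \<open>P\<close> is only required of simple graphs.\<close>
  have "measure_pmf.prob ?M F = measure_pmf.prob ?M (F \<inter> set_pmf ?M)"
    by (simp add: measure_Int_set_pmf)
  also have "\<dots> \<le> measure_pmf.prob ?M (hop_edges n E -` {E'. P E'})"
    by (rule measure_pmf.finite_measure_mono) (use assms set_hop_choices[OF assms(1,2)] in auto)
  finally show ?thesis by (simp add: two_hop_step_alt)
qed

lemma prob_step_single:
  assumes "simple_graph n E" "\<And>x. x < n \<Longrightarrow> nbrs E x \<noteq> {}" "x < n"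
    and "\<And>f. f x \<in> W \<Longrightarrow> simple_graph n (hop_edges n E f) \<Longrightarrow> P (hop_edges n E f)"
  shows "measure_pmf.prob (two_hop_choice E x) W \<le> measure_pmf.prob (two_hop_step n E) {E'. P E'}"
proof -
  have "two_hop_choice E x = map_pmf (\<lambda>f. f x) (Pi_pmf {..<n} 0 (two_hop_choice E))"
    using assms(3) by (simp add: Pi_pmf_component)
  then have "measure_pmf.prob (two_hop_choice E x) W =
      measure_pmf.prob (Pi_pmf {..<n} 0 (two_hop_choice E)) ((\<lambda>f. f x) -` W)"
    by simp
  also have "\<dots> \<le> measure_pmf.prob (two_hop_step n E) {E'. P E'}"
    by (rule prob_step_ge_choices[OF assms(1,2)]) (use assms(4) in auto)
  finally show ?thesis .
qed

lemma exp_minus_le_half: "0 \<le> r \<Longrightarrow> r \<le> 1 \<Longrightarrow> exp (- r) \<le> 1 - r / (2::real)"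
proof -
  assume r: "0 \<le> r" "r \<le> 1"
  have "exp r \<ge> 1 + r" by simp
  then have "exp (- r) \<le> 1 / (1 + r)" using r by (simp add: exp_minus divide_simps)
  also have "\<dots> \<le> 1 - r / 2"
    using r mult_mono[of r 1 r r] by (simp add: divide_simps) (simp add: algebra_simps)
  finally show ?thesis .
qed

text \<open>By independence all vertices of \<open>V\<close> miss \<open>b\<close> with probability
  at most exp(-r), where \<open>r\<close> bounds the expected number of hits from below. For
  \<open>r\<close> in [0,1] this is at most 1 - r/2, whence the loss of a factor 2.\<close>

lemma prob_step_some:
  assumes E: "simple_graph n E" "\<And>x. x < n \<Longrightarrow> nbrs E x \<noteq> {}" and V: "V \<subseteq> {..<n}"
    and P: "\<And>f x. x \<in> V \<Longrightarrow> f x = b \<Longrightarrow> simple_graph n (hop_edges n E f) \<Longrightarrow> P (hop_edges n E f)"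
    and r: "r \<le> (\<Sum>x\<in>V. measure_pmf.prob (two_hop_choice E x) {b})" "0 \<le> r" "r \<le> 1"
  shows "r / 2 \<le> measure_pmf.prob (two_hop_step n E) {E'. P E'}"
proof -
  let ?M = "Pi_pmf {..<n} 0 (two_hop_choice E)"
  let ?p = "\<lambda>x. measure_pmf.prob (two_hop_choice E x) {b}"
  let ?B = "\<lambda>x. if x \<in> V then - {b} else UNIV"
  have fV: "finite V" using V finite_subset by blast
  have "measure_pmf.prob ?M (Pi {..<n} ?B) = (\<Prod>x<n. measure_pmf.prob (two_hop_choice E x) (?B x))"
    by (rule measure_Pi_pmf_Pi) simp
  also have "\<dots> = (\<Prod>x\<in>V. measure_pmf.prob (two_hop_choice E x) (- {b}))"
    using V by (intro prod.mono_neutral_cong_right) auto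
  also have "\<dots> = (\<Prod>x\<in>V. 1 - ?p x)"
    using measure_pmf.prob_compl by (intro prod.cong) (auto simp: Compl_eq_Diff_UNIV)
  also have "\<dots> \<le> (\<Prod>x\<in>V. exp (- ?p x))"
    by (intro prod_mono) (use exp_ge_add_one_self[of "- _"] in \<open>auto simp: algebra_simps\<close>)
  also have "\<dots> = exp (- (\<Sum>x\<in>V. ?p x))" using fV by (simp add: exp_sum sum_negf[symmetric])
  also have "\<dots> \<le> exp (- r)" using r by simp
  also have "\<dots> \<le> 1 - r / 2" using r by (intro exp_minus_le_half)
  finally have "r / 2 \<le> 1 - measure_pmf.prob ?M (Pi {..<n} ?B)" by simp
  also have "\<dots> = measure_pmf.prob ?M (- Pi {..<n} ?B)"
    using measure_pmf.prob_compl[of "Pi {..<n} ?B" ?M] by (simp add: Compl_eq_Diff_UNIV)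
  also have "\<dots> \<le> measure_pmf.prob (two_hop_step n E) {E'. P E'}"
    by (rule prob_step_ge_choices[OF E]) (use P in \<open>auto simp: Pi_def split: if_splits\<close>)
  finally show ?thesis .
qed

subsection \<open>Local structure around a poor vertex\<close>

definition cnbrs :: "nat set set \<Rightarrow> nat \<Rightarrow> nat set" where
  "cnbrs E u = insert u (nbrs E u)"

text \<open>The threshold \<open>d\<close> stays fixed during a phase while \<open>E\<close> grows,
  so the core can only grow. This is what makes the counters below monotone.\<close>

definition core :: "nat set set \<Rightarrow> nat \<Rightarrow> nat \<Rightarrow> nat set" where
  "core E d u = {z \<in> cnbrs E u. d \<le> 2 * card (nbrs E z \<inter> cnbrs E u)}"

text \<open>A stronger condition than the core, which supplies the degree bounds for a single round.
  A typical vertex may lose this status when it gains neighbours outside, so no counter is built on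
  it.\<close>

definition typical :: "nat set set \<Rightarrow> nat \<Rightarrow> nat set" where
  "typical E u = {v \<in> cnbrs E u. 8 * card (nbrs E v - cnbrs E u) \<le> card (nbrs E v)}"

definition tie :: "nat set set \<Rightarrow> nat \<Rightarrow> nat \<Rightarrow> nat \<Rightarrow> nat" where
  "tie E d u b = card (nbrs E b \<inter> core E d u)"

lemma finite_cnbrs: "simple_graph n E \<Longrightarrow> finite (cnbrs E u)"
  by (simp add: cnbrs_def finite_nbrs)

lemma cnbrs_subset: "simple_graph n E \<Longrightarrow> u < n \<Longrightarrow> cnbrs E u \<subseteq> {..<n}"
  using nbrs_subset[of n E u] by (auto simp: cnbrs_def)

lemma card_cnbrs: "simple_graph n E \<Longrightarrow> card (cnbrs E u) = Suc (card (nbrs E u))"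
  by (simp add: cnbrs_def finite_nbrs nbrs_irrefl)

lemma cnbrs_mono: "E \<subseteq> E' \<Longrightarrow> cnbrs E u \<subseteq> cnbrs E' u"
  using nbrs_mono[of E E' u] by (auto simp: cnbrs_def)

lemma core_subset: "core E d u \<subseteq> cnbrs E u"
  by (auto simp: core_def)

lemma core_mono:
  assumes "simple_graph n E'" "E \<subseteq> E'"
  shows "core E d u \<subseteq> core E' d u"
proof
  fix z assume z: "z \<in> core E d u"
  have "card (nbrs E z \<inter> cnbrs E u) \<le> card (nbrs E' z \<inter> cnbrs E' u)"
    by (rule card_mono) (use assms nbrs_mono[of E E' z] cnbrs_mono[of E E' u] finite_nbrs in auto)
  with z cnbrs_mono[OF assms(2), of u] show "z \<in> core E' d u"
    by (auto simp: core_def)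
qed

lemma tie_mono:
  assumes "simple_graph n E'" "E \<subseteq> E'"
  shows "tie E d u b \<le> tie E' d u b"
  unfolding tie_def
  by (rule card_mono) (use assms nbrs_mono[of E E' b] core_mono[OF assms, of d u] finite_nbrs in auto)

text \<open>Double counting of the adjacent pairs between \<open>V\<close> and
  \<open>Z\<close>.\<close>

lemma sum_card_swap:
  assumes "finite V" "finite Z"
  shows "(\<Sum>v\<in>V. card (nbrs E v \<inter> Z)) = (\<Sum>z\<in>Z. card (nbrs E z \<inter> V))"
proof -
  have "(\<Sum>v\<in>V. card (nbrs E v \<inter> Z)) = (\<Sum>v\<in>V. \<Sum>z\<in>Z. if z \<in> nbrs E v then 1 else 0)"
    using assms by (intro sum.cong) (auto simp: sum.If_cases Int_commute Int_def)
  also have "\<dots> = (\<Sum>z\<in>Z. \<Sum>v\<in>V. if v \<in> nbrs E z then 1 else 0)"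
    by (subst sum.swap) (simp add: nbrs_sym)
  also have "\<dots> = (\<Sum>z\<in>Z. card (nbrs E z \<inter> V))"
    using assms by (intro sum.cong) (auto simp: sum.If_cases Int_commute Int_def)
  finally show ?thesis .
qed

text \<open>A snapshot in the middle of a phase: \<open>d\<close> bounds all degrees from below, and
  \<open>u\<close> has not yet reached the target 2d.\<close>

locale poor_node =
  fixes n :: nat and E :: "nat set set" and d u :: nat
  assumes simple: "simple_graph n E"
    and d_pos: "1 \<le> d"
    and min_degree: "\<And>x. x < n \<Longrightarrow> d \<le> card (nbrs E x)"
    and u: "u < n"
    and poor: "card (nbrs E u) < 2 * d"
begin

abbreviation "A \<equiv> cnbrs E u"
abbreviation "S \<equiv> core E d u"
abbreviation "Y \<equiv> typical E u"

lemma fin: "finite A" "finite S" "finite Y" "finite (nbrs E x)"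
  using finite_cnbrs[OF simple, of u] finite_nbrs[OF simple, of x]
  by (auto simp: core_def typical_def)

lemma A_bound: "A \<subseteq> {..<n}" by (rule cnbrs_subset[OF simple u])

lemma card_A: "card A \<le> 2 * d" using card_cnbrs[OF simple, of u] poor by simp

lemma card_A_n: "card A \<le> n" using card_mono[OF _ A_bound] by simp

lemma nbrs_ne: "x < n \<Longrightarrow> nbrs E x \<noteq> {}"
  using min_degree[of x] d_pos by fastforce

lemma d_le_n: "d \<le> n" using min_degree[OF u] card_nbrs_le[OF simple, of u] by simp

lemma u_core: "u \<in> S"
proof -
  have "nbrs E u \<inter> A = nbrs E u" by (auto simp: cnbrs_def)
  then show ?thesis using min_degree[OF u] by (simp add: core_def cnbrs_def)
qed

lemma u_typical: "u \<in> Y"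
proof -
  have no_out: "nbrs E u - A = {}" and "u \<in> A" by (auto simp: cnbrs_def)
  have "card (nbrs E u - A) = 0" unfolding no_out by simp
  then show ?thesis unfolding typical_def using \<open>u \<in> A\<close> by (metis (no_types, lifting) mem_Collect_eq mult_0_right zero_le)
qed

lemma card_split: "card (nbrs E v) = card (nbrs E v \<inter> A) + card (nbrs E v - A)"
  using card_Int_Diff[of "nbrs E v" A] fin by simp

text \<open>At least 7/8 of the neighbours lie in \<open>A\<close>, which has at most 2d elements,
  so the degree is at most 16d/7.\<close>

lemma typicalD:
  assumes "v \<in> Y"
  shows "v \<in> A" "card (nbrs E v) \<le> 3 * d" "7 * d \<le> 8 * card (nbrs E v \<inter> A)"
proof -
  show vA: "v \<in> A" using assms by (simp add: typical_def)
  have 1: "8 * card (nbrs E v - A) \<le> card (nbrs E v)" using assms by (simp add: typical_def)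
  have 2: "card (nbrs E v \<inter> A) \<le> 2 * d"
    using card_mono[of A "nbrs E v \<inter> A"] fin card_A by simp
  have 3: "d \<le> card (nbrs E v)" using min_degree vA A_bound by auto
  show "card (nbrs E v) \<le> 3 * d" using 1 2 card_split[of v] by linarith
  show "7 * d \<le> 8 * card (nbrs E v \<inter> A)" using 1 3 card_split[of v] by linarith
qed

lemma typical_core: "Y \<subseteq> S"
proof
  fix v assume "v \<in> Y"
  from typicalD[OF this] show "v \<in> S" by (simp add: core_def)
qed

text \<open>More than d/8 of the fewer than 2d neighbours of \<open>u\<close> are atypical, so the
  first hop finds one with probability above 1/16; from there the second hop leaves \<open>A\<close>
  with probability above 1/8.\<close>

lemma prob_size_grows:
  assumes "d < 8 * card (A - Y)"
  shows "1 / 128 \<le> measure_pmf.prob (two_hop_step n E) {E'. card A < card (cnbrs E' u)}"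
proof -
  have sub: "A - Y \<subseteq> nbrs E u" using u_typical by (auto simp: cnbrs_def)
  have "real (card (A - Y)) / 8 = (\<Sum>v\<in>A - Y. 1 / 8)" by simp
  also have "\<dots> \<le> (\<Sum>v\<in>A - Y. real (card (nbrs E v \<inter> - A)) / real (card (nbrs E v)))"
  proof (rule sum_mono)
    fix v assume v: "v \<in> A - Y"
    then have "v < n" using A_bound by auto
    then have "0 < card (nbrs E v)" using min_degree[of v] d_pos by simp
    moreover have "card (nbrs E v) \<le> 8 * card (nbrs E v - A)" using v by (auto simp: typical_def)
    ultimately show "1 / 8 \<le> real (card (nbrs E v \<inter> - A)) / real (card (nbrs E v))"
      by (simp add: Diff_eq divide_simps)
  qed
  also have "\<dots> \<le> (\<Sum>v\<in>nbrs E u. real (card (nbrs E v \<inter> - A)) / real (card (nbrs E v)))"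
    by (rule sum_mono2) (use sub fin in auto)
  finally have "real (card (A - Y)) / 8 / card (nbrs E u) \<le> measure_pmf.prob (two_hop_choice E u) (- A)"
    unfolding prob_two_hop_choice[OF simple nbrs_ne[OF u]] by (rule divide_right_mono) simp
  moreover have "1 / 128 \<le> real (card (A - Y)) / 8 / card (nbrs E u)"
    using assms poor min_degree[OF u] d_pos by (simp add: divide_simps)
  moreover have "measure_pmf.prob (two_hop_choice E u) (- A)
      \<le> measure_pmf.prob (two_hop_step n E) {E'. card A < card (cnbrs E' u)}"
  proof (rule prob_step_single[OF simple nbrs_ne u])
    fix f assume f: "f u \<in> - A" "simple_graph n (hop_edges n E f)"
    have "f u \<noteq> u" using f by (auto simp: cnbrs_def)
    then have "{u, f u} \<in> hop_edges n E f" using u by (auto simp: hop_edges_def)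
    then have "f u \<in> cnbrs (hop_edges n E f) u" by (simp add: cnbrs_def nbrs_def)
    moreover have "A \<subseteq> cnbrs (hop_edges n E f) u" by (rule cnbrs_mono) (auto simp: hop_edges_def)
    ultimately have "A \<subset> cnbrs (hop_edges n E f) u" using f by auto
    then show "card A < card (cnbrs (hop_edges n E f) u)"
      using finite_cnbrs[OF f(2)] by (rule psubset_card_mono[rotated])
  qed
  ultimately show ?thesis by linarith
qed

end

text \<open>The case complementary to \<open>prob_size_grows\<close>: replacing \<open>A\<close> by
  its typical vertices costs at most d/8 in any count.\<close>

locale cliquish_node = poor_node +
  assumes few_atypical: "8 * card (A - Y) \<le> d"
begin

lemma card_Int_le_typical: "card (X \<inter> A) \<le> card (X \<inter> Y) + card (A - Y)"
proof -
  have "card (X \<inter> A) \<le> card ((X \<inter> Y) \<union> (A - Y))"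
    by (rule card_mono) (use fin in auto)
  also have "\<dots> \<le> card (X \<inter> Y) + card (A - Y)" by (rule card_Un_le)
  finally show ?thesis .
qed

text \<open>A neighbour of \<open>z\<close> in \<open>A\<close> is atypical, or typical and not
  adjacent to \<open>b\<close>, or typical and adjacent to \<open>b\<close>; in the last case it is
  a tie of \<open>b\<close>, since typical vertices are core.\<close>

lemma card_typical_unlinked:
  "card (nbrs E z \<inter> A) \<le> card (nbrs E z \<inter> (Y - nbrs E b)) + card (A - Y) + tie E d u b"
proof -
  have "card (nbrs E z \<inter> Y) \<le> card (nbrs E z \<inter> (Y - nbrs E b) \<union> nbrs E b \<inter> S)"
    by (rule card_mono) (use fin typical_core in auto)
  also have "\<dots> \<le> card (nbrs E z \<inter> (Y - nbrs E b)) + tie E d u b"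
    unfolding tie_def by (rule card_Un_le)
  finally show ?thesis using card_Int_le_typical[of "nbrs E z"] by linarith
qed

lemma tie_le_typical: "tie E d u b \<le> card (nbrs E b \<inter> Y) + card (A - Y)"
proof -
  have "tie E d u b \<le> card (nbrs E b \<inter> A)"
    unfolding tie_def by (rule card_mono) (use fin core_subset[of E d u] in auto)
  then show ?thesis using card_Int_le_typical[of "nbrs E b"] by linarith
qed

text \<open>The count runs over the core neighbours of b while it has few ties. Such a neighbour may
  have only about d/2 typical neighbours, too few once b has d/4 ties; but then at least half
  of the ties of b are to typical vertices, which have almost 7d/8 neighbours in A.\<close>

lemma sum_common_ge:
  assumes k: "2 * tie E d u b < d"
  shows "tie E d u b * d \<le> 8 * (\<Sum>v\<in>Y - nbrs E b. card (nbrs E v \<inter> nbrs E b))"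
proof -
  let ?k = "tie E d u b" and ?V = "Y - nbrs E b"
  have sum_ge: "(\<Sum>z\<in>Z. card (nbrs E z \<inter> ?V)) \<le> (\<Sum>v\<in>?V. card (nbrs E v \<inter> nbrs E b))"
    if "Z \<subseteq> nbrs E b" for Z
  proof -
    have fZ: "finite Z" using that fin finite_subset by blast
    have "(\<Sum>z\<in>Z. card (nbrs E z \<inter> ?V)) = (\<Sum>v\<in>?V. card (nbrs E v \<inter> Z))"
      using fin fZ by (intro sum_card_swap) auto
    also have "\<dots> \<le> (\<Sum>v\<in>?V. card (nbrs E v \<inter> nbrs E b))"
      by (intro sum_mono card_mono) (use fin that in auto)
    finally show ?thesis .
  qed
  show ?thesis
  proof (cases "4 * ?k < d")
    case True
    have "?k * d = (\<Sum>z\<in>nbrs E b \<inter> S. d)" by (simp add: tie_def)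
    also have "\<dots> \<le> (\<Sum>z\<in>nbrs E b \<inter> S. 8 * card (nbrs E z \<inter> ?V))"
    proof (rule sum_mono)
      fix z assume "z \<in> nbrs E b \<inter> S"
      then have "d \<le> 2 * card (nbrs E z \<inter> A)" by (simp add: core_def)
      \<comment> \<open>The count is at least d/2 - d/8 - d/4 = d/8.\<close>
      then show "d \<le> 8 * card (nbrs E z \<inter> ?V)"
        using card_typical_unlinked[of z b] few_atypical True by linarith
    qed
    also have "\<dots> \<le> 8 * (\<Sum>v\<in>?V. card (nbrs E v \<inter> nbrs E b))"
      using sum_ge[of "nbrs E b \<inter> S"] by (simp add: sum_distrib_left[symmetric])
    finally show ?thesis .
  next
    case False
    \<comment> \<open>At most d/8 of the ties are atypical, which is at most half of
      \<open>?k\<close> because \<open>?k\<close> is at least d/4.\<close>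
    have "?k * d \<le> card (nbrs E b \<inter> Y) * (2 * d)"
      using tie_le_typical[of b] few_atypical False mult_le_mono1[of ?k "2 * card (nbrs E b \<inter> Y)" d]
      by (simp add: mult.assoc mult.left_commute)
    also have "\<dots> = (\<Sum>z\<in>nbrs E b \<inter> Y. 2 * d)" by simp
    also have "\<dots> \<le> (\<Sum>z\<in>nbrs E b \<inter> Y. 8 * card (nbrs E z \<inter> ?V))"
    proof (rule sum_mono)
      fix z assume "z \<in> nbrs E b \<inter> Y"
      then have "7 * d \<le> 8 * card (nbrs E z \<inter> A)" using typicalD by blast
      \<comment> \<open>The count is at least 7d/8 - d/8 - d/2 = d/4.\<close>
      then show "2 * d \<le> 8 * card (nbrs E z \<inter> ?V)"
        using card_typical_unlinked[of z b] few_atypical k by linarith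
    qed
    also have "\<dots> \<le> 8 * (\<Sum>v\<in>?V. card (nbrs E v \<inter> nbrs E b))"
      using sum_ge[of "nbrs E b \<inter> Y"] by (simp add: sum_distrib_left[symmetric])
    finally show ?thesis .
  qed
qed

text \<open>Each common neighbour \<open>z\<close> is a route from \<open>v\<close> to
  \<open>b\<close>: it is picked with probability at least 1/(3d) as \<open>v\<close> is typical,
  and \<open>b\<close> is then picked with probability at least 1/n.\<close>

lemma prob_choice_typical_ge:
  assumes v: "v \<in> Y"
  shows "real (card (nbrs E v \<inter> nbrs E b)) / (3 * real d * real n)
    \<le> measure_pmf.prob (two_hop_choice E v) {b}"
proof -
  have vn: "v < n" using typicalD(1)[OF v] A_bound by auto
  have pos: "0 < card (nbrs E v)" using min_degree[OF vn] d_pos by simp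
  have "real (card (nbrs E v \<inter> nbrs E b)) / n = (\<Sum>z\<in>nbrs E v \<inter> nbrs E b. 1 / n)" by simp
  also have "\<dots> \<le> (\<Sum>z\<in>nbrs E v \<inter> nbrs E b. real (card (nbrs E z \<inter> {b})) / real (card (nbrs E z)))"
  proof (rule sum_mono)
    fix z assume z: "z \<in> nbrs E v \<inter> nbrs E b"
    then have "nbrs E z \<inter> {b} = {b}" using nbrs_sym by auto
    moreover have "0 < card (nbrs E z)"
      using z fin(4)[of z] nbrs_sym[of z E b] by (auto simp: card_gt_0_iff)
    ultimately show "1 / n \<le> real (card (nbrs E z \<inter> {b})) / real (card (nbrs E z))"
      using card_nbrs_le[OF simple, of z] by (simp add: divide_simps)
  qed
  also have "\<dots> \<le> (\<Sum>z\<in>nbrs E v. real (card (nbrs E z \<inter> {b})) / real (card (nbrs E z)))"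
    by (rule sum_mono2) (use fin in auto)
  finally have "real (card (nbrs E v \<inter> nbrs E b)) / n / card (nbrs E v) \<le> measure_pmf.prob (two_hop_choice E v) {b}"
    unfolding prob_two_hop_choice[OF simple nbrs_ne[OF vn]] by (rule divide_right_mono) simp
  moreover have "real (card (nbrs E v \<inter> nbrs E b)) / (3 * real d * real n)
      \<le> real (card (nbrs E v \<inter> nbrs E b)) / n / card (nbrs E v)"
  proof -
    have "real (card (nbrs E v)) * real n \<le> 3 * real d * real n"
      using typicalD(2)[OF v] by (intro mult_right_mono) auto
    then show ?thesis using pos vn
      by (simp add: divide_divide_eq_left mult.commute) (intro divide_left_mono, auto simp: mult.commute)
  qed
  ultimately show ?thesis by linarith
qed

text \<open>Any typical vertex not yet adjacent to \<open>b\<close> becomes a new tie if it picks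
  \<open>b\<close>. The constant is 8 from \<open>sum_common_ge\<close>, times 3 from the degree
  bound, times 2 from \<open>prob_step_some\<close>.\<close>

lemma prob_tie_grows:
  assumes k: "2 * tie E d u b < d"
  shows "real (tie E d u b) / (48 * n)
    \<le> measure_pmf.prob (two_hop_step n E) {E'. tie E d u b < tie E' d u b}"
proof -
  let ?k = "tie E d u b" and ?V = "Y - nbrs E b"
  have n0: "0 < n" using u by simp
  have "real ?k / (24 * n) = (?k * d) / (24 * d * n)" using d_pos by simp
  also have "\<dots> \<le> real (8 * (\<Sum>v\<in>?V. card (nbrs E v \<inter> nbrs E b))) / (24 * d * n)"
    using sum_common_ge[OF k] by (intro divide_right_mono) (simp_all only: of_nat_le_iff of_nat_0_le_iff)
  also have "\<dots> = (\<Sum>v\<in>?V. real (card (nbrs E v \<inter> nbrs E b)) / (3 * real d * real n))"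
    by (simp add: sum_divide_distrib[symmetric])
  also have "\<dots> \<le> (\<Sum>v\<in>?V. measure_pmf.prob (two_hop_choice E v) {b})"
    by (intro sum_mono prob_choice_typical_ge) auto
  finally have r: "real ?k / (24 * n) \<le> (\<Sum>v\<in>?V. measure_pmf.prob (two_hop_choice E v) {b})" .
  \<comment> \<open>This ensures that a vertex picking \<open>b\<close> differs from
    \<open>b\<close>, so that a genuine edge appears. A typical \<open>b\<close> would have at least
    7d/8 - d/8 = 3d/4 ties.\<close>
  have b: "b \<notin> Y"
  proof
    assume "b \<in> Y"
    then have "7 * d \<le> 8 * card (nbrs E b \<inter> A)" by (rule typicalD)
    moreover have "card (nbrs E b \<inter> Y) \<le> ?k"
      unfolding tie_def by (rule card_mono) (use fin typical_core in auto)
    ultimately show False using card_Int_le_typical[of "nbrs E b"] few_atypical k d_pos by linarith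
  qed
  have "real ?k / (24 * n) / 2 \<le> measure_pmf.prob (two_hop_step n E) {E'. ?k < tie E' d u b}"
  proof (rule prob_step_some[OF simple nbrs_ne _ _ r])
    show "?V \<subseteq> {..<n}" using typicalD(1) A_bound by auto
    show "real ?k / (24 * n) \<le> 1" using k d_le_n n0 by (simp add: divide_simps)
    fix f v assume v: "v \<in> ?V" "f v = b" and s: "simple_graph n (hop_edges n E f)"
    let ?E = "hop_edges n E f"
    have sub: "E \<subseteq> ?E" by (auto simp: hop_edges_def)
    have vn: "v < n" using v typicalD(1) A_bound by auto
    have "v \<noteq> b" using v b by auto
    then have "{v, f v} \<in> ?E" using v vn by (auto simp: hop_edges_def)
    then have "v \<in> nbrs ?E b" using v by (simp add: nbrs_def insert_commute)
    moreover have "v \<in> core ?E d u" using v typical_core core_mono[OF s sub] by auto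
    moreover have "nbrs E b \<inter> S \<subseteq> nbrs ?E b \<inter> core ?E d u"
      using nbrs_mono[OF sub] core_mono[OF s sub] by blast
    ultimately have "nbrs E b \<inter> S \<subset> nbrs ?E b \<inter> core ?E d u" using v by auto
    then show "?k < tie ?E d u b"
      unfolding tie_def using finite_nbrs[OF s] by (intro psubset_card_mono) auto
  qed (use fin in auto)
  then show ?thesis by simp
qed

text \<open>At least d/2 - d/8 = 3d/8 typical vertices are adjacent to \<open>b\<close>. They are
  neighbours of \<open>u\<close> and have degree at most 3d, so their second-hop probabilities of
  reaching \<open>b\<close> sum to at least 1/8.\<close>

lemma prob_link:
  assumes k: "d \<le> 2 * tie E d u b" and b: "b \<notin> A"
  shows "1 / (16 * n) \<le> measure_pmf.prob (two_hop_step n E) {E'. b \<in> cnbrs E' u}"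
proof -
  \<comment> \<open>A typical vertex is \<open>u\<close> or a neighbour of \<open>u\<close>, and
    \<open>u\<close> is excluded because \<open>b\<close> lies outside \<open>A\<close>.\<close>
  have sub: "nbrs E b \<inter> Y \<subseteq> nbrs E u"
    using b typicalD(1) nbrs_sym[of b E u] by (auto simp: cnbrs_def)
  have ge: "3 * d \<le> 8 * card (nbrs E b \<inter> Y)"
    using tie_le_typical[of b] few_atypical k by linarith
  have "1 / 8 \<le> real (card (nbrs E b \<inter> Y)) / (3 * d)"
    using ge d_pos by (simp add: divide_simps)
  also have "\<dots> = (\<Sum>z\<in>nbrs E b \<inter> Y. 1 / (3 * d))" by simp
  also have "\<dots> \<le> (\<Sum>z\<in>nbrs E b \<inter> Y. real (card (nbrs E z \<inter> {b})) / real (card (nbrs E z)))"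
  proof (rule sum_mono)
    fix z assume z: "z \<in> nbrs E b \<inter> Y"
    then have "nbrs E z \<inter> {b} = {b}" using nbrs_sym by auto
    moreover have "0 < card (nbrs E z)"
      using z fin(4)[of z] nbrs_sym[of z E b] by (auto simp: card_gt_0_iff)
    ultimately show "1 / (3 * d) \<le> real (card (nbrs E z \<inter> {b})) / real (card (nbrs E z))"
      using typicalD(2)[of z] z d_pos by (simp add: divide_simps)
  qed
  also have "\<dots> \<le> (\<Sum>z\<in>nbrs E u. real (card (nbrs E z \<inter> {b})) / real (card (nbrs E z)))"
    by (rule sum_mono2) (use fin sub in auto)
  finally have "1 / 8 / card (nbrs E u) \<le> measure_pmf.prob (two_hop_choice E u) {b}"
    unfolding prob_two_hop_choice[OF simple nbrs_ne[OF u]] by (rule divide_right_mono) simp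
  moreover have "1 / (16 * n) \<le> 1 / 8 / real (card (nbrs E u))"
    using card_nbrs_le[OF simple, of u] min_degree[OF u] d_pos by (simp add: divide_simps)
  moreover have "measure_pmf.prob (two_hop_choice E u) {b}
      \<le> measure_pmf.prob (two_hop_step n E) {E'. b \<in> cnbrs E' u}"
  proof (rule prob_step_single[OF simple nbrs_ne u])
    fix f assume f: "f u \<in> {b}" "simple_graph n (hop_edges n E f)"
    have "f u \<noteq> u" using f b by (auto simp: cnbrs_def)
    then have "{u, f u} \<in> hop_edges n E f" using u by (auto simp: hop_edges_def)
    then show "b \<in> cnbrs (hop_edges n E f) u" using f by (simp add: cnbrs_def nbrs_def)
  qed
  ultimately show ?thesis by linarith
qed

end

subsection \<open>Counters and their drift\<close>

datatype counter = Size | Tie nat | Link nat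

text \<open>The values are shifted to be at least 1, so that their product can be inverted.\<close>

fun counter_value :: "nat \<Rightarrow> nat \<Rightarrow> nat set set \<Rightarrow> counter \<Rightarrow> nat" where
  "counter_value d u E Size = card (cnbrs E u)"
| "counter_value d u E (Tie b) = Suc (tie E d u b)"
| "counter_value d u E (Link b) = (if b \<in> cnbrs E u then 2 else 1)"

lemma count_mono:
  assumes "simple_graph n E'" "E \<subseteq> E'"
  shows "counter_value d u E c \<le> counter_value d u E' c"
  using tie_mono[OF assms] cnbrs_mono[OF assms(2), of u]
    card_mono[OF finite_cnbrs[OF assms(1)] cnbrs_mono[OF assms(2)]]
  by (cases c) auto

lemma count_pos: "simple_graph n E \<Longrightarrow> 1 \<le> counter_value d u E c"
  by (cases c) (auto simp: card_cnbrs)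

lemma count_le: "simple_graph n E \<Longrightarrow> 1 \<le> n \<Longrightarrow> counter_value d u E c \<le> n + 1"
proof (cases c)
  case (Tie b)
  assume E: "simple_graph n E"
  have "tie E d u b \<le> card (nbrs E b)"
    unfolding tie_def by (rule card_mono) (use finite_nbrs[OF E] in auto)
  then show ?thesis using Tie card_nbrs_le[OF E, of b] by simp
next
  case Size
  assume "simple_graph n E"
  then show ?thesis using Size card_nbrs_le[of n E u] by (simp add: card_cnbrs)
qed auto

definition weight :: "nat \<Rightarrow> nat \<Rightarrow> counter set \<Rightarrow> nat set set \<Rightarrow> real" where
  "weight d u I E = (\<Prod>c\<in>I. real (counter_value d u E c))"

lemma weight_pos: "simple_graph n E \<Longrightarrow> 0 < weight d u I E"
  unfolding weight_def using count_pos[of n E d u] by (intro prod_pos) (simp add: Suc_le_eq)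

lemma weight_ge_1: "simple_graph n E \<Longrightarrow> 1 \<le> weight d u I E"
  unfolding weight_def using count_pos[of n E d u] by (intro prod_ge_1) (metis of_nat_1 of_nat_mono)

lemma weight_le:
  assumes "simple_graph n E" "1 \<le> n" "card I \<le> k"
  shows "weight d u I E \<le> (real n + 1) ^ k"
proof -
  have "weight d u I E \<le> (\<Prod>c\<in>I. real n + 1)"
    unfolding weight_def using count_le[OF assms(1,2), of d u]
    by (intro prod_mono) (metis of_nat_0_le_iff of_nat_1 of_nat_add of_nat_mono)
  also have "\<dots> \<le> (real n + 1) ^ k" using assms(3) by (simp add: power_increasing)
  finally show ?thesis .
qed

lemma weight_mono:
  assumes "simple_graph n E'" "E \<subseteq> E'"
  shows "weight d u I E \<le> weight d u I E'"
  unfolding weight_def using count_mono[OF assms] by (intro prod_mono) auto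

lemma weight_increase:
  assumes E: "simple_graph n E" "simple_graph n E'" "E \<subseteq> E'" and I: "finite I" "c \<in> I"
    and inc: "counter_value d u E c < counter_value d u E' c"
  shows "weight d u I E * (1 + 1 / counter_value d u E c) \<le> weight d u I E'"
proof -
  let ?R = "\<lambda>F. \<Prod>c\<in>I - {c}. real (counter_value d u F c)"
  have w: "weight d u I F = counter_value d u F c * ?R F" for F
    unfolding weight_def using I by (simp add: prod.remove)
  have "1 \<le> counter_value d u E c" by (rule count_pos[OF E(1)])
  then have "weight d u I E * (1 + 1 / counter_value d u E c) = (counter_value d u E c + 1) * ?R E"
    by (simp add: w field_simps)
  also have "\<dots> \<le> counter_value d u E' c * ?R E'"
    using inc count_mono[OF E(2,3)] by (intro mult_mono prod_mono prod_nonneg) auto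
  finally show ?thesis by (simp add: w)
qed

text \<open>Multiplicative drift: a single counter that grows at a rate proportional to its value
  already shrinks the reciprocal of the whole product, because all counters are monotone.\<close>

lemma inverse_weight_drift:
  fixes a :: real
  assumes E: "simple_graph n E" "\<And>x. x < n \<Longrightarrow> nbrs E x \<noteq> {}" and I: "finite I" "c \<in> I"
    and rate: "a * counter_value d u E c \<le> measure_pmf.prob (two_hop_step n E) {E'. counter_value d u E c < counter_value d u E' c}"
    and a: "0 \<le> a"
  shows "measure_pmf.expectation (two_hop_step n E) (\<lambda>E'. 1 / weight d u I E')
    \<le> (1 - a / 2) * (1 / weight d u I E)"
proof -
  let ?M = "two_hop_step n E" and ?w = "weight d u I" and ?x = "counter_value d u E c"
  let ?Q = "{E'. counter_value d u E c < counter_value d u E' c}"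
  have fin: "finite (set_pmf ?M)"
    by (rule finite_subset[OF _ finite_simple_graphs[of n]]) (use set_two_hop_step[OF E] in auto)
  have x: "1 \<le> ?x" by (rule count_pos[OF E(1)])
  have "measure_pmf.expectation ?M (\<lambda>E'. 1 / ?w E')
      \<le> measure_pmf.expectation ?M (\<lambda>E'. 1 / ?w E - indicator ?Q E' * (1 / ((?x + 1) * ?w E)))"
  proof (rule integral_mono_AE)
    show "AE E' in measure_pmf ?M. 1 / ?w E' \<le> 1 / ?w E - indicator ?Q E' * (1 / ((?x + 1) * ?w E))"
      unfolding AE_measure_pmf_iff
    proof
      fix E' assume "E' \<in> set_pmf ?M"
      note E' = set_two_hop_step[OF E this]
      have pos: "0 < ?w E" "0 < ?w E'" using weight_pos E(1) E'(2) by auto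
      show "1 / ?w E' \<le> 1 / ?w E - indicator ?Q E' * (1 / ((?x + 1) * ?w E))"
      proof (cases "E' \<in> ?Q")
        case True
        then have "?w E * (1 + 1 / ?x) \<le> ?w E'"
          using weight_increase[OF E(1) E'(2,1) I] by simp
        then have "1 / ?w E' \<le> 1 / (?w E * (1 + 1 / ?x))"
          using pos by (intro divide_left_mono mult_pos_pos) (auto intro: add_pos_nonneg)
        \<comment> \<open>Growth of a counter with value x removes at least the fraction 1/(x+1) of
          the reciprocal.\<close>
        also have "\<dots> = 1 / ?w E - 1 / ((?x + 1) * ?w E)"
          using pos x by (simp add: divide_simps)
        finally show ?thesis using True by simp
      next
        case False
        then show ?thesis using weight_mono[OF E'(2,1), of d u I] pos by (simp add: frac_le)
      qed
    qed
  qed (use fin in \<open>auto intro: integrable_measure_pmf_finite\<close>)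
  also have "\<dots> = 1 / ?w E - measure_pmf.prob ?M ?Q * (1 / ((?x + 1) * ?w E))"
    by (subst Bochner_Integration.integral_diff) (use fin in \<open>auto intro: integrable_measure_pmf_finite\<close>)
  also have "\<dots> \<le> 1 / ?w E - a * ?x * (1 / ((?x + 1) * ?w E))"
    using rate weight_pos[OF E(1), of d u I] by (intro diff_mono mult_right_mono) auto
  also have "\<dots> \<le> (1 - a / 2) * (1 / ?w E)"
  proof -
    \<comment> \<open>The rate a*x times the removed fraction 1/(x+1) is at least a/2 because x is
      at least 1.\<close>
    have "1 / 2 \<le> ?x / (?x + 1 :: real)" using x by (simp add: divide_simps)
    then have "a * (1 / 2) * (1 / ?w E) \<le> a * (?x / (?x + 1)) * (1 / ?w E)"
      using a weight_pos[OF E(1), of d u I] by (intro mult_right_mono mult_left_mono) auto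
    then show ?thesis by (simp add: algebra_simps diff_divide_distrib)
  qed
  finally show ?thesis .
qed

text \<open>All walk vertices are included, so the family stays fixed although the vertex that
  currently makes progress changes.\<close>

definition walk_counters :: "(nat \<Rightarrow> nat) \<Rightarrow> nat \<Rightarrow> counter set" where
  "walk_counters p m = insert Size (Tie ` p ` {..m} \<union> Link ` p ` {..m})"

lemma finite_walk_counters: "finite (walk_counters p m)"
  by (simp add: walk_counters_def)

lemma card_walk_counters: "card (walk_counters p m) \<le> 2 * m + 3"
proof -
  have "card (f ` p ` {..m}) \<le> m + 1" for f :: "nat \<Rightarrow> counter"
    using card_image_le[of "p ` {..m}" f] card_image_le[of "{..m}" p] by simp
  from add_mono[OF this[of Tie] this[of Link]]
  have "card (Tie ` p ` {..m}) + card (Link ` p ` {..m}) \<le> 2 * m + 2" by simp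
  then have "card (Tie ` p ` {..m} \<union> Link ` p ` {..m}) \<le> 2 * m + 2"
    using card_Un_le order_trans by blast
  moreover have "card (walk_counters p m) \<le> Suc (card (Tie ` p ` {..m} \<union> Link ` p ` {..m}))"
    unfolding walk_counters_def by (simp add: card_insert_if)
  ultimately show ?thesis by linarith
qed

context poor_node
begin

text \<open>Progress happens at \<open>Size\<close>, or at the first walk vertex outside the core:
  its predecessor is core, so it already has a tie. It then gains ties while it has fewer than d/2,
  and a link to \<open>u\<close> afterwards.\<close>

lemma some_counter_grows:
  assumes p: "p 0 = u" "\<And>i. i < m \<Longrightarrow> {p i, p (Suc i)} \<in> E" and far: "p m \<notin> cnbrs E u"
  shows "\<exists>c\<in>walk_counters p m. 1 / (128 * real n) * counter_value d u E c
    \<le> measure_pmf.prob (two_hop_step n E) {E'. counter_value d u E c < counter_value d u E' c}"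
proof (cases "8 * card (A - Y) \<le> d")
  case False
  have "1 / (128 * real n) * card A \<le> 1 / 128"
    using card_A_n u by (simp add: divide_simps)
  also have "\<dots> \<le> measure_pmf.prob (two_hop_step n E) {E'. card A < card (cnbrs E' u)}"
    using False by (intro prob_size_grows) simp
  finally show ?thesis by (intro bexI[of _ Size]) (auto simp: walk_counters_def)
next
  case True
  interpret cliquish_node n E d u by unfold_locales (rule True)
  define i where "i = (LEAST i. p i \<notin> S)"
  have m: "p m \<notin> S" using far core_subset[of E d u] by auto
  have iS: "p i \<notin> S" unfolding i_def by (rule LeastI[of "\<lambda>i. p i \<notin> S", OF m])
  have im: "i \<le> m" unfolding i_def by (rule Least_le) (rule m)
  have "i \<noteq> 0" using iS u_core p by (cases i) auto
  then obtain j where j: "i = Suc j" by (cases i) auto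
  then have "p j \<in> S" using not_less_Least[of j "\<lambda>i. p i \<notin> S"] by (auto simp: i_def)
  moreover have "p j \<in> nbrs E (p i)" using p(2)[of j] im j by (simp add: nbrs_def insert_commute)
  ultimately have "nbrs E (p i) \<inter> S \<noteq> {}" by auto
  then have k: "1 \<le> tie E d u (p i)" unfolding tie_def using fin by (simp add: Suc_le_eq card_gt_0_iff)
  have mem: "Tie (p i) \<in> walk_counters p m" "Link (p i) \<in> walk_counters p m"
    using im by (auto simp: walk_counters_def)
  show ?thesis
  proof (cases "2 * tie E d u (p i) < d")
    case True
    \<comment> \<open>The shift in the counter is harmless: k + 1 is at most 2k for k at least
      1.\<close>
    have "1 / (128 * real n) * Suc (tie E d u (p i)) \<le> tie E d u (p i) / (48 * n)"
      using k u by (simp add: divide_simps)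
    also note prob_tie_grows[OF True]
    finally show ?thesis by (intro bexI[OF _ mem(1)]) simp
  next
    case False
    \<comment> \<open>All ties lie in \<open>A\<close>, so a member of \<open>A\<close> with d/2
      ties would be core.\<close>
    have "p i \<notin> A"
    proof
      assume "p i \<in> A"
      moreover have "tie E d u (p i) \<le> card (nbrs E (p i) \<inter> A)"
        unfolding tie_def by (rule card_mono) (use fin core_subset[of E d u] in auto)
      ultimately show False using iS False by (simp add: core_def)
    qed
    have "1 / (128 * real n) \<le> 1 / (16 * real n)" using u by (simp add: divide_simps)
    also have "\<dots> \<le> measure_pmf.prob (two_hop_step n E) {E'. p i \<in> cnbrs E' u}"
      using prob_link[OF _ \<open>p i \<notin> A\<close>] False by simp
    also have "\<dots> = measure_pmf.prob (two_hop_step n E) {E'. counter_value d u E (Link (p i)) < counter_value d u E' (Link (p i))}"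
      using \<open>p i \<notin> A\<close> by (intro arg_cong[of _ _ "measure_pmf.prob _"]) auto
    finally show ?thesis using \<open>p i \<notin> A\<close> by (intro bexI[OF _ mem(2)]) simp
  qed
qed

end

subsection \<open>One phase of the process\<close>

lemma nonempty_nbrs_mono:
  assumes "E \<subseteq> E'" "nbrs E x \<noteq> {}"
  shows "nbrs E' x \<noteq> {}"
  using nbrs_mono[OF assms(1), of x] assms(2) by blast

lemma set_two_hop_process:
  assumes "simple_graph n E0" "\<And>x. x < n \<Longrightarrow> nbrs E0 x \<noteq> {}"
    and "E \<in> set_pmf (two_hop_process n E0 t)"
  shows "E0 \<subseteq> E" "simple_graph n E"
proof -
  have "E0 \<subseteq> E \<and> simple_graph n E"
    using assms(3)
  proof (induction t arbitrary: E)
    case 0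
    then show ?case using assms(1) by simp
  next
    case (Suc t)
    then obtain F where F: "F \<in> set_pmf (two_hop_process n E0 t)" "E \<in> set_pmf (two_hop_step n F)"
      by auto
    have "E0 \<subseteq> F" "simple_graph n F" using Suc.IH[OF F(1)] by auto
    then show ?case
      using set_two_hop_step[OF _ nonempty_nbrs_mono[OF _ assms(2)] F(2)] by blast
  qed
  then show "E0 \<subseteq> E" "simple_graph n E" by auto
qed

lemma finite_set_two_hop_process:
  assumes "simple_graph n E0" "\<And>x. x < n \<Longrightarrow> nbrs E0 x \<noteq> {}"
  shows "finite (set_pmf (two_hop_process n E0 t))"
  by (rule finite_subset[OF _ finite_simple_graphs[of n]]) (use set_two_hop_process[OF assms] in auto)

lemma two_hop_process_add:
  "two_hop_process n E0 (s + t) = two_hop_process n E0 s \<bind> (\<lambda>E. two_hop_process n E t)"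
  by (induction t) (simp_all add: bind_return_pmf' bind_assoc_pmf)

lemma two_hop_process_drift:
  fixes g :: "nat set set \<Rightarrow> real"
  assumes E0: "simple_graph n E0" "\<And>x. x < n \<Longrightarrow> nbrs E0 x \<noteq> {}" and rho: "0 \<le> \<rho>"
    and step: "\<And>E. simple_graph n E \<Longrightarrow> E0 \<subseteq> E \<Longrightarrow> measure_pmf.expectation (two_hop_step n E) g \<le> \<rho> * g E"
  shows "measure_pmf.expectation (two_hop_process n E0 t) g \<le> \<rho> ^ t * g E0"
proof (induction t)
  case 0
  then show ?case by simp
next
  case (Suc t)
  let ?M = "two_hop_process n E0 t"
  note fin = finite_set_two_hop_process[OF E0, of t]
  have fin_step: "finite (set_pmf (two_hop_step n E))" if "E \<in> set_pmf ?M" for E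
  proof -
    have "set_pmf (two_hop_step n E) \<subseteq> set_pmf (two_hop_process n E0 (Suc t))" using that by auto
    then show ?thesis using finite_set_two_hop_process[OF E0, of "Suc t"] finite_subset by blast
  qed
  have "measure_pmf.expectation (two_hop_process n E0 (Suc t)) g
      = measure_pmf.expectation ?M (\<lambda>E. measure_pmf.expectation (two_hop_step n E) g)"
    unfolding two_hop_process.simps by (rule expectation_bind_finite[OF fin fin_step])
  also have "\<dots> \<le> measure_pmf.expectation ?M (\<lambda>E. \<rho> * g E)"
    by (rule integral_mono_AE)
      (use fin set_two_hop_process[OF E0] step in \<open>auto intro: integrable_measure_pmf_finite simp: AE_measure_pmf_iff\<close>)
  also have "\<dots> = \<rho> * measure_pmf.expectation ?M g" by simp
  also have "\<dots> \<le> \<rho> * (\<rho> ^ t * g E0)" using Suc.IH rho by (rule mult_left_mono)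
  finally show ?case by (simp add: mult.assoc)
qed

text \<open>The reciprocal weight, cut off to 0 outside \<open>far\<close>, contracts by 1 -
  1/(256n) in every round. It starts at no more than 1 and is at least 1/K on \<open>far\<close>,
  where K is the bound from \<open>weight_le\<close>; Markov's inequality concludes.\<close>

lemma prob_poor_and_far:
  assumes E0: "simple_graph n E0" and d: "1 \<le> d" "\<And>x. x < n \<Longrightarrow> d \<le> card (nbrs E0 x)"
    and u: "u < n" and p: "p 0 = u" "\<And>i. i < m \<Longrightarrow> {p i, p (Suc i)} \<in> E0"
  shows "measure_pmf.prob (two_hop_process n E0 t) {E. card (nbrs E u) < 2 * d \<and> p m \<notin> cnbrs E u}
    \<le> (real n + 1) ^ (2 * m + 3) * (1 - 1 / (256 * real n)) ^ t"
proof -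
  define far where "far = {E. card (nbrs E u) < 2 * d \<and> p m \<notin> cnbrs E u}"
  define I where "I = walk_counters p m"
  define g where "g E = indicator far E * (1 / weight d u I E)" for E
  let ?\<rho> = "1 - 1 / (256 * real n)" and ?K = "(real n + 1) ^ (2 * m + 3)"
  have ne: "nbrs E0 x \<noteq> {}" if "x < n" for x using d(2)[OF that] d(1) by fastforce
  have rho: "0 \<le> ?\<rho>" using u by (simp add: divide_simps)
  have step: "measure_pmf.expectation (two_hop_step n E) g \<le> ?\<rho> * g E"
    if E: "simple_graph n E" "E0 \<subseteq> E" for E
  proof -
    have neE: "nbrs E x \<noteq> {}" if "x < n" for x using nonempty_nbrs_mono[OF E(2) ne[OF that]] .
    have st: "E \<subseteq> E'" "simple_graph n E'" if "E' \<in> set_pmf (two_hop_step n E)" for E'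
      using set_two_hop_step[OF E(1) neE that] by auto
    have fin_step: "finite (set_pmf (two_hop_step n E))"
      by (rule finite_subset[OF _ finite_simple_graphs[of n]]) (use st in auto)
    show ?thesis
    proof (cases "E \<in> far")
      case True
      have deg: "d \<le> card (nbrs E x)" if "x < n" for x
        using d(2)[OF that] card_mono[OF finite_nbrs[OF E(1)] nbrs_mono[OF E(2)], of x] by linarith
      interpret poor_node n E d u
        using E(1) d(1) deg u True by unfold_locales (auto simp: far_def)
      obtain c where c: "c \<in> I" "1 / (128 * real n) * counter_value d u E c
          \<le> measure_pmf.prob (two_hop_step n E) {E'. counter_value d u E c < counter_value d u E' c}"
        using some_counter_grows[of p m] p E(2) True unfolding I_def far_def by auto
      have "measure_pmf.expectation (two_hop_step n E) g
          \<le> measure_pmf.expectation (two_hop_step n E) (\<lambda>E'. 1 / weight d u I E')"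
      proof (rule integral_mono_AE)
        show "AE E' in measure_pmf (two_hop_step n E). g E' \<le> 1 / weight d u I E'"
          unfolding AE_measure_pmf_iff g_def
          using less_imp_le[OF weight_pos[OF st(2), of _ d u I]] by (auto simp: indicator_def)
      qed (use fin_step in \<open>auto intro: integrable_measure_pmf_finite\<close>)
      also have "\<dots> \<le> (1 - 1 / (128 * real n) / 2) * (1 / weight d u I E)"
        by (rule inverse_weight_drift[OF E(1) neE _ c]) (simp_all add: I_def finite_walk_counters)
      finally show ?thesis using True by (simp add: g_def)
    next
      case False
      \<comment> \<open>Once left, \<open>far\<close> is never entered again, since degrees and
        closed neighbourhoods only grow.\<close>
      have "g E' = 0" if "E' \<in> set_pmf (two_hop_step n E)" for E'
      proof -
        note E' = st[OF that]
        have "card (nbrs E u) \<le> card (nbrs E' u)"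
          by (rule card_mono[OF finite_nbrs[OF E'(2)] nbrs_mono[OF E'(1)]])
        then have "E' \<notin> far" using False cnbrs_mono[OF E'(1), of u] by (auto simp: far_def)
        then show ?thesis by (simp add: g_def)
      qed
      then have "measure_pmf.expectation (two_hop_step n E) g = measure_pmf.expectation (two_hop_step n E) (\<lambda>_. 0)"
        by (intro integral_cong_AE) (auto simp: AE_measure_pmf_iff)
      then show ?thesis using False by (simp add: g_def)
    qed
  qed
  have fin: "finite (set_pmf (two_hop_process n E0 t))" by (rule finite_set_two_hop_process[OF E0 ne])
  have "measure_pmf.prob (two_hop_process n E0 t) far
      = measure_pmf.expectation (two_hop_process n E0 t) (indicator far)" by simp
  also have "\<dots> \<le> measure_pmf.expectation (two_hop_process n E0 t) (\<lambda>E. ?K * g E)"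
  proof (rule integral_mono_AE)
    show "AE E in measure_pmf (two_hop_process n E0 t). indicator far E \<le> ?K * g E"
      unfolding AE_measure_pmf_iff
    proof
      fix E assume "E \<in> set_pmf (two_hop_process n E0 t)"
      then have E: "simple_graph n E" using set_two_hop_process[OF E0 ne] by blast
      have "weight d u I E \<le> ?K"
        using weight_le[OF E _ card_walk_counters[of p m]] u by (simp add: I_def)
      then show "indicator far E \<le> ?K * g E"
        using weight_pos[OF E, of d u I] by (simp add: g_def indicator_def)
    qed
  qed (use fin in \<open>auto intro: integrable_measure_pmf_finite\<close>)
  also have "\<dots> = ?K * measure_pmf.expectation (two_hop_process n E0 t) g" by simp
  also have "\<dots> \<le> ?K * (?\<rho> ^ t * g E0)"
    by (intro mult_left_mono two_hop_process_drift[OF E0 ne rho step]) auto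
  also have "\<dots> \<le> ?K * (?\<rho> ^ t * 1)"
    using weight_ge_1[OF E0, of d u I] rho
    by (intro mult_left_mono) (auto simp: g_def indicator_def)
  finally show ?thesis by (simp add: far_def)
qed

text \<open>If the ball of radius 2 is not everything, there is a vertex \<open>y\<close> at
  distance 3. The closed neighbourhoods of \<open>u\<close> and \<open>y\<close> in
  \<open>E0\<close> are disjoint, have at least d + 1 elements each, and lie in the ball of radius
  4.\<close>

lemma degree_doubles_of_ball:
  assumes E0: "simple_graph n E0" "connected_graph n E0" and d: "\<And>x. x < n \<Longrightarrow> d \<le> card (nbrs E0 x)"
    and E: "simple_graph n E" and u: "u < n"
    and near: "\<And>w m. m \<le> 4 \<Longrightarrow> (u, w) \<in> adj_rel E0 ^^ m \<Longrightarrow> w \<in> cnbrs E u"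
  shows "min (2 * d) (n - 1) \<le> card (nbrs E u)"
proof (cases "{..<n} \<subseteq> {w. \<exists>m\<le>2. (u, w) \<in> adj_rel E0 ^^ m}")
  case True
  have "{..<n} \<subseteq> cnbrs E u"
  proof
    fix w assume "w \<in> {..<n}"
    with True obtain m where "m \<le> 2" "(u, w) \<in> adj_rel E0 ^^ m" by blast
    then show "w \<in> cnbrs E u" using near[of m w] by simp
  qed
  then have "n \<le> card (cnbrs E u)" using card_mono[OF finite_cnbrs[OF E], of "{..<n}"] by simp
  then show ?thesis using card_cnbrs[OF E, of u] by simp
next
  case False
  let ?R = "adj_rel E0" and ?B = "{w. \<exists>m\<le>2. (u, w) \<in> adj_rel E0 ^^ m}"
  have R: "(x, y) \<in> ?R \<longleftrightarrow> y \<in> nbrs E0 x" for x y by (simp add: adj_rel_def nbrs_def)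
  obtain z where z: "z < n" "z \<notin> ?B" using False by auto
  have "(u, z) \<in> ?R\<^sup>*" using E0(2) u z by (auto simp: connected_graph_def)
  moreover have "u \<in> ?B" by force
  \<comment> \<open>A path from \<open>u\<close> to \<open>z\<close> must cross the boundary of the
    ball.\<close>
  ultimately obtain x y where xy: "x \<in> ?B" "y \<notin> ?B" "(x, y) \<in> ?R"
    using z(2) by (induction rule: rtrancl_induct) blast+
  then obtain m where m: "m \<le> 2" "(u, x) \<in> ?R ^^ m" by auto
  then have y: "(u, y) \<in> ?R ^^ Suc m" using xy by auto
  have yn: "y < n" using xy(3) simple_graph_edgeD[OF E0(1)] by (auto simp: adj_rel_def)
  have in_E: "cnbrs E0 u \<union> cnbrs E0 y \<subseteq> cnbrs E u"
  proof
    fix w assume "w \<in> cnbrs E0 u \<union> cnbrs E0 y"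
    then consider "w = u" | "(u, w) \<in> ?R" | "w = y" | "(y, w) \<in> ?R" by (auto simp: cnbrs_def R)
    then show "w \<in> cnbrs E u"
    proof cases
      case 1
      then show ?thesis by (simp add: cnbrs_def)
    next
      case 2
      then show ?thesis using near[of 1 w] by simp
    next
      case 3
      then show ?thesis using near[of "Suc m" w] y m by simp
    next
      case 4
      then show ?thesis using near[of "Suc (Suc m)" w] y m by auto
    qed
  qed
  have "w \<notin> cnbrs E0 y" if "w \<in> cnbrs E0 u" for w
  proof
    assume "w \<in> cnbrs E0 y"
    then have wy: "w = y \<or> (w, y) \<in> ?R" by (auto simp: cnbrs_def R nbrs_sym)
    have uw: "w = u \<or> (u, w) \<in> ?R" using that by (auto simp: cnbrs_def R)
    have "(u, y) \<in> ?R ^^ 0 \<or> (u, y) \<in> ?R ^^ 1 \<or> (u, y) \<in> ?R ^^ 2"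
      using wy uw by (auto simp: numeral_2_eq_2)
    then show False using xy(2) by (auto dest: spec[of _ "0::nat"] spec[of _ "1::nat"] spec[of _ "2::nat"])
  qed
  then have "cnbrs E0 u \<inter> cnbrs E0 y = {}" by auto
  then have "card (cnbrs E0 u) + card (cnbrs E0 y) \<le> card (cnbrs E u)"
    using card_mono[OF finite_cnbrs[OF E] in_E] finite_cnbrs[OF E0(1)] by (simp add: card_Un_disjoint)
  then show ?thesis
    using d[OF u] d[OF yn] card_cnbrs[OF E0(1)] card_cnbrs[OF E] by simp
qed

subsection \<open>Doubling the minimum degree\<close>

lemma connected_graph_mono:
  assumes "connected_graph n E" "E \<subseteq> E'"
  shows "connected_graph n E'"
proof -
  have "(adj_rel E)\<^sup>* \<subseteq> (adj_rel E')\<^sup>*"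
    by (rule rtrancl_mono) (use assms(2) in \<open>auto simp: adj_rel_def\<close>)
  then show ?thesis using assms(1) by (auto simp: connected_graph_def)
qed

text \<open>This keeps \<open>pmf_of_set\<close> meaningful: every uniform choice is made from a
  nonempty set.\<close>

lemma connected_nbrs_nonempty:
  assumes "connected_graph n E" "2 \<le> n" "x < n"
  shows "nbrs E x \<noteq> {}"
proof -
  define y :: nat where "y = (if x = 0 then 1 else 0)"
  have y: "y < n" "y \<noteq> x" using assms(2,3) by (auto simp: y_def)
  then have "(x, y) \<in> (adj_rel E)\<^sup>*" using assms by (auto simp: connected_graph_def)
  then obtain z where "(x, z) \<in> adj_rel E" using y(2) by (metis converse_rtranclE)
  then show ?thesis by (auto simp: adj_rel_def nbrs_def)
qed

text \<open>The exponent 11 is 2*4 + 3, the maximal number of counters for walks of length at most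
  4. As 6400 = 25*256, the decay is n^(-25), against (n+1)^11 which is at most n^22.\<close>

lemma failure_bound:
  assumes "2 \<le> n" "6400 * real n * ln n \<le> real t"
  shows "(real n + 1) ^ 11 * (1 - 1 / (256 * real n)) ^ t \<le> 1 / real n ^ 3"
proof -
  have n: "0 < real n" using assms by simp
  have "(1 - 1 / (256 * real n)) ^ t \<le> exp (- (1 / (256 * real n))) ^ t"
    using assms(1) exp_ge_add_one_self[of "- (1 / (256 * real n))"]
    by (intro power_mono) (auto simp: divide_simps)
  also have "\<dots> = exp (- (real t / (256 * real n)))" by (simp add: exp_of_nat_mult[symmetric])
  also have "\<dots> \<le> exp (- (25 * ln n))"
    using assms n by (simp add: divide_simps mult_ac)
  also have "\<dots> = 1 / real n ^ 25"
    using n by (simp add: exp_minus divide_inverse exp_of_nat_mult[of 25 "ln (real n)", simplified])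
  finally have 1: "(1 - 1 / (256 * real n)) ^ t \<le> 1 / real n ^ 25" .
  have "real n + 1 \<le> real n ^ 2"
  proof -
    have "2 * real n \<le> real n * real n" using assms(1) by (intro mult_right_mono) auto
    then show ?thesis using assms(1) unfolding power2_eq_square by linarith
  qed
  then have "(real n + 1) ^ 11 \<le> (real n ^ 2) ^ 11" by (intro power_mono) auto
  then have "(real n + 1) ^ 11 \<le> real n ^ 22" by simp
  then have "(real n + 1) ^ 11 * (1 - 1 / (256 * real n)) ^ t \<le> real n ^ 22 * (1 / real n ^ 25)"
    using 1 assms(1) by (intro mult_mono) (auto simp: divide_simps)
  also have "\<dots> = 1 / real n ^ 3" using n by (simp add: field_simps flip: power_add)
  finally show ?thesis .
qed

text \<open>Union bound over at most n^2 pairs of a vertex and a target in its initial ball, each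
  failing with probability at most n^(-3).\<close>

lemma prob_degree_doubles:
  assumes E0: "simple_graph n E0" "connected_graph n E0" and n: "2 \<le> n"
    and d: "1 \<le> d" "\<And>x. x < n \<Longrightarrow> d \<le> card (nbrs E0 x)"
    and t: "6400 * real n * ln n \<le> real t"
  shows "1 - 1 / n \<le> measure_pmf.prob (two_hop_process n E0 t) {E. \<forall>u<n. min (2 * d) (n - 1) \<le> card (nbrs E u)}"
proof -
  let ?M = "two_hop_process n E0 t"
  define near where "near = {(u, w). u < n \<and> w < n \<and> (\<exists>m\<le>4. (u, w) \<in> adj_rel E0 ^^ m)}"
  define bad where "bad = (\<lambda>(u, w). {E. card (nbrs E u) < 2 * d \<and> w \<notin> cnbrs E u})"
  let ?G = "{E. \<forall>u<n. min (2 * d) (n - 1) \<le> card (nbrs E u)}"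
  have ne: "nbrs E0 x \<noteq> {}" if "x < n" for x using d(2)[OF that] d(1) by fastforce
  have sub: "near \<subseteq> {..<n} \<times> {..<n}" by (auto simp: near_def)
  have fin: "finite near" using sub finite_subset by blast
  have bad_le: "measure_pmf.prob ?M (bad uw) \<le> 1 / real n ^ 3" if "uw \<in> near" for uw
  proof -
    obtain u w m where uw: "uw = (u, w)" "u < n" "m \<le> 4" "(u, w) \<in> adj_rel E0 ^^ m"
      using \<open>uw \<in> near\<close> by (auto simp: near_def)
    then obtain p where p: "p 0 = u" "p m = w" "\<And>i. i < m \<Longrightarrow> (p i, p (Suc i)) \<in> adj_rel E0"
      unfolding relpow_fun_conv by blast
    have "measure_pmf.prob ?M (bad uw) \<le> (real n + 1) ^ (2 * m + 3) * (1 - 1 / (256 * real n)) ^ t"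
      using prob_poor_and_far[where p = p and m = m and t = t, OF E0(1) d uw(2) p(1)] p(2,3) by (simp add: bad_def uw(1) adj_rel_def)
    also have "\<dots> \<le> (real n + 1) ^ 11 * (1 - 1 / (256 * real n)) ^ t"
      using uw(3) n by (intro mult_right_mono power_increasing zero_le_power) (auto simp: divide_simps)
    also have "\<dots> \<le> 1 / real n ^ 3" by (rule failure_bound[OF n t])
    finally show ?thesis .
  qed
  have "E \<in> (\<Union>uw\<in>near. bad uw)" if E: "E \<in> set_pmf ?M" "E \<notin> ?G" for E
  proof (rule ccontr)
    assume none: "E \<notin> (\<Union>uw\<in>near. bad uw)"
    note E' = set_two_hop_process[OF E0(1) ne E(1)]
    obtain u where u: "u < n" "card (nbrs E u) < min (2 * d) (n - 1)" using E(2) by (auto simp: not_le)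
    have "min (2 * d) (n - 1) \<le> card (nbrs E u)"
    proof (rule degree_doubles_of_ball[OF E0 d(2) E'(2) u(1)])
      fix w m assume m: "m \<le> 4" "(u, w) \<in> adj_rel E0 ^^ m"
      have "w < n"
      proof (cases m)
        case 0
        then show ?thesis using m u by simp
      next
        case (Suc k)
        then obtain v where "(v, w) \<in> adj_rel E0" using m by auto
        then show ?thesis using simple_graph_edgeD[OF E0(1)] by (auto simp: adj_rel_def)
      qed
      then have "(u, w) \<in> near" using m u by (auto simp: near_def)
      then show "w \<in> cnbrs E u" using none u by (auto simp: bad_def)
    qed
    then show False using u(2) by linarith
  qed
  then have "measure_pmf.prob ?M (- ?G) \<le> measure_pmf.prob ?M (\<Union>uw\<in>near. bad uw)"
    by (intro measure_pmf.finite_measure_mono_AE) (auto simp: AE_measure_pmf_iff)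
  also have "\<dots> \<le> (\<Sum>uw\<in>near. measure_pmf.prob ?M (bad uw))"
    by (rule measure_pmf.finite_measure_subadditive_finite[OF fin]) auto
  also have "\<dots> \<le> (\<Sum>uw\<in>near. 1 / real n ^ 3)" by (intro sum_mono bad_le)
  also have "\<dots> = real (card near) / real n ^ 3" by simp
  also have "\<dots> \<le> real (n * n) / real n ^ 3"
    using card_mono[OF _ sub] by (intro divide_right_mono of_nat_mono) auto
  also have "\<dots> = 1 / n" using n by (simp add: power3_eq_cube divide_simps)
  finally show ?thesis
    using measure_pmf.prob_compl[of ?G ?M] by (simp add: Compl_eq_Diff_UNIV)
qed

text \<open>Phases are chained by restarting from the current graph, which is still simple and
  connected. Connectivity gives the initial degree bound 1.\<close>

lemma prob_degree_power:
  assumes E0: "simple_graph n E0" "connected_graph n E0" and n: "2 \<le> n"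
    and t: "6400 * real n * ln n \<le> real t"
  shows "1 - j / n \<le> measure_pmf.prob (two_hop_process n E0 (j * t)) {E. \<forall>u<n. min (2 ^ j) (n - 1) \<le> card (nbrs E u)}"
proof (induction j)
  case 0
  have "1 \<le> card (nbrs E0 u)" if "u < n" for u
    using connected_nbrs_nonempty[OF E0(2) n that] finite_nbrs[OF E0(1), of u] by (simp add: Suc_le_eq card_gt_0_iff)
  then show ?case by (auto simp: indicator_def intro: min.coboundedI1)
next
  case (Suc j)
  have ne: "nbrs E0 x \<noteq> {}" if "x < n" for x by (rule connected_nbrs_nonempty[OF E0(2) n that])
  let ?d = "min (2 ^ j) (n - 1)"
  have "1 - (j / n + 1 / n) \<le> measure_pmf.prob (two_hop_process n E0 (j * t) \<bind> (\<lambda>E. two_hop_process n E t))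
      {E. \<forall>u<n. min (2 ^ Suc j) (n - 1) \<le> card (nbrs E u)}"
  proof (rule prob_bind_ge[OF Suc.IH])
    fix E assume deg: "E \<in> {E. \<forall>u<n. ?d \<le> card (nbrs E u)}" and "E \<in> set_pmf (two_hop_process n E0 (j * t))"
    note E = set_two_hop_process[OF E0(1) ne this(2)]
    have "1 - 1 / n \<le> measure_pmf.prob (two_hop_process n E t) {E. \<forall>u<n. min (2 * ?d) (n - 1) \<le> card (nbrs E u)}"
      by (rule prob_degree_doubles[OF E(2) connected_graph_mono[OF E0(2) E(1)] n _ _ t]) (use deg n in auto)
    moreover have "min (2 * ?d) (n - 1) = min (2 ^ Suc j) (n - 1)" by (auto simp: min_def)
    ultimately show "1 - 1 / n \<le> measure_pmf.prob (two_hop_process n E t) {E. \<forall>u<n. min (2 ^ Suc j) (n - 1) \<le> card (nbrs E u)}"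
      by simp
  qed simp
  then show ?case by (simp add: two_hop_process_add[symmetric] add.commute add_divide_distrib)
qed

section \<open>From large minimum degree to the complete graph\<close>

lemma complete_graphI:
  assumes "simple_graph n E" "\<And>u. u < n \<Longrightarrow> n - 1 \<le> card (nbrs E u)"
  shows "E = complete_graph n"
proof
  show "E \<subseteq> complete_graph n" using assms(1) by (simp add: simple_graph_def complete_graph_def)
  show "complete_graph n \<subseteq> E"
  proof
    fix e assume "e \<in> complete_graph n"
    then obtain x y where e: "e = {x, y}" "x < n" "y < n" "x \<noteq> y"
      by (auto simp: complete_graph_def all_pairs_def)
    have "nbrs E x \<subseteq> {..<n} - {x}" using nbrs_subset[OF assms(1)] nbrs_irrefl[OF assms(1)] by auto
    moreover have "card ({..<n} - {x}) \<le> card (nbrs E x)" using assms(2)[OF e(2)] e(2) by simp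
    ultimately have "nbrs E x = {..<n} - {x}" by (intro card_seteq) auto
    then have "y \<in> nbrs E x" using e by simp
    then show "e \<in> E" using e by (simp add: nbrs_def)
  qed
qed

text \<open>The complete graph is absorbing, so the rounds left after the \<open>j\<close> phases
  add no failure probability.\<close>

lemma prob_complete_ge:
  assumes E0: "simple_graph n E0" "connected_graph n E0" and n: "2 \<le> n"
    and t: "6400 * real n * ln n \<le> real t" and j: "n \<le> 2 ^ j" and T: "j * t \<le> T"
  shows "1 - j / n \<le> pmf (two_hop_process n E0 T) (complete_graph n)"
proof -
  have ne: "nbrs E0 x \<noteq> {}" if "x < n" for x by (rule connected_nbrs_nonempty[OF E0(2) n that])
  obtain s where s: "T = j * t + s" using T le_Suc_ex by blast
  have "1 - (real j / n + 0) \<le> measure_pmf.prob (two_hop_process n E0 (j * t) \<bind> (\<lambda>E. two_hop_process n E s)) {complete_graph n}"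
  proof (rule prob_bind_ge[OF prob_degree_power[OF E0 n t]])
    fix E assume deg: "E \<in> {E. \<forall>u<n. min (2 ^ j) (n - 1) \<le> card (nbrs E u)}"
      and "E \<in> set_pmf (two_hop_process n E0 (j * t))"
    note E = set_two_hop_process[OF E0(1) ne this(2)]
    have full: "n - 1 \<le> card (nbrs E u)" if "u < n" for u
      using deg that j by (simp add: min_absorb2)
    have complete: "E = complete_graph n" by (rule complete_graphI[OF E(2) full])
    have neE: "nbrs E x \<noteq> {}" if "x < n" for x by (rule nonempty_nbrs_mono[OF E(1) ne[OF that]])
    have "F = complete_graph n" if "F \<in> set_pmf (two_hop_process n E s)" for F
      using set_two_hop_process[OF E(2) neE that] complete by (auto simp: simple_graph_def complete_graph_def)
    then have "AE F in measure_pmf (two_hop_process n E s). F \<in> {complete_graph n}"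
      by (auto simp: AE_measure_pmf_iff)
    then show "1 - 0 \<le> measure_pmf.prob (two_hop_process n E s) {complete_graph n}"
      using measure_pmf.prob_eq_1[of "{complete_graph n}" "two_hop_process n E s"] by simp
  qed simp
  then show ?thesis by (simp add: s two_hop_process_add measure_pmf_single)
qed

theorem theorem12:
  "\<exists>C C' :: real. C > 0 \<and> C' > 0 \<and>
     (\<forall>n::nat. \<forall>E0. n \<ge> 2 \<longrightarrow> simple_graph n E0 \<longrightarrow> connected_graph n E0 \<longrightarrow>
        pmf (two_hop_process n E0 (nat \<lceil>C * real n * (ln (real n))\<^sup>2\<rceil>)) (complete_graph n)
          \<ge> 1 - C' * ln (real n) / real n)"
proof (rule exI[of _ 25608], rule exI[of _ 4], intro conjI allI impI)
  fix n :: nat and E0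
  assume n: "2 \<le> n" and E0: "simple_graph n E0" "connected_graph n E0"
  \<comment> \<open>There are \<open>j\<close> phases of \<open>t\<close> rounds. The bounds 4 ln n
    on \<open>j\<close> and 6402 n ln n on \<open>t\<close> give 25608 = 4*6402, and the failure
    bound j/n gives the constant 4.\<close>
  define t where "t = nat \<lceil>6400 * real n * ln n\<rceil>"
  define j where "j = nat \<lceil>log 2 n\<rceil>"
  have ln2: "1 / 2 \<le> ln (2::real)" using ln2_ge_two_thirds by simp
  have "ln (2::real) \<le> ln n" using n by simp
  then have lnn: "1 / 2 \<le> ln n" using ln2 by linarith
  have "2 * (1 / 2) \<le> real n * ln n" using n lnn by (intro mult_mono) auto
  then have nln: "1 \<le> real n * ln n" by simp
  have t: "6400 * real n * ln n \<le> real t" unfolding t_def by (rule real_nat_ceiling_ge)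
  have t_le: "real t \<le> 6402 * (real n * ln n)"
  proof -
    have "real t \<le> 6400 * real n * ln n + 1" using nln unfolding t_def by (simp add: of_nat_nat)
    then show ?thesis using nln by simp
  qed
  have j: "n \<le> 2 ^ j"
  proof -
    have "log 2 n \<le> real j" unfolding j_def by (rule real_nat_ceiling_ge)
    then have "real n \<le> 2 powr real j" using n by (simp add: log_le_iff)
    then have "real n \<le> real (2 ^ j)" by (simp add: powr_realpow)
    then show ?thesis by (simp only: of_nat_le_iff)
  qed
  have j_le: "real j \<le> 4 * ln n"
  proof -
    \<comment> \<open>Rounding up at most doubles log 2 n, and ln 2 being at least 1/2 costs another
      factor 2.\<close>
    have "1 \<le> log 2 n" using n by simp
    then have "real j \<le> log 2 n + 1" unfolding j_def by (simp add: of_nat_nat)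
    also have "\<dots> \<le> 2 * log 2 n" using n by simp
    also have "\<dots> \<le> 4 * ln n"
    proof -
      have "ln n * (1 / 2) \<le> ln n * ln 2" using lnn ln2 by (intro mult_left_mono) auto
      then show ?thesis using ln2 unfolding log_def by (simp add: divide_simps)
    qed
    finally show ?thesis .
  qed
  have "real (j * t) \<le> 4 * ln n * (6402 * (real n * ln n))"
    unfolding of_nat_mult using j_le t_le lnn by (intro mult_mono) auto
  also have "\<dots> = 25608 * real n * (ln n)\<^sup>2" by (simp add: power2_eq_square)
  also have "\<dots> \<le> real (nat \<lceil>25608 * real n * (ln n)\<^sup>2\<rceil>)" by (rule real_nat_ceiling_ge)
  finally have "j * t \<le> nat \<lceil>25608 * real n * (ln n)\<^sup>2\<rceil>" by (simp only: of_nat_le_iff)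
  from prob_complete_ge[OF E0 n t j this]
  have "1 - j / n \<le> pmf (two_hop_process n E0 (nat \<lceil>25608 * real n * (ln n)\<^sup>2\<rceil>)) (complete_graph n)" .
  moreover have "j / n \<le> 4 * ln n / n" using j_le by (rule divide_right_mono) simp
  ultimately show "1 - 4 * ln n / n \<le> pmf (two_hop_process n E0 (nat \<lceil>25608 * real n * (ln n)\<^sup>2\<rceil>)) (complete_graph n)"
    by linarith
qed simp_all

end
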